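(* Given any finite Markov decision process $(\mathcal S,\mathcal A,p,r,\hat{\boldsymbol p})$ with horizon $T=1$ and any $\alpha\in[0,1]$, $$\max_{\pi\in\Pi}\ \mathrm{VaR}_\alpha^{\tilde a\sim\boldsymbol\pi(\tilde s)}\big[r(\tilde s,\tilde a,\tilde s')\big]=\sup_{\boldsymbol\zeta\in\Delta_S}\Big\{\min_{s\in\mathcal S}\ \max_{\boldsymbol d\in\Delta_A}\ \mathrm{VaR}_{\alpha\zeta_s\hat p_s^{-1}}^{\tilde a\sim\boldsymbol d}\big[r(s,\tilde a,\tilde s')\mid\tilde s=s\big]\ \Big|\ \alpha\,\zeta_s\le\hat p_s\ \text{for all } s\in\mathcal S\Big\}.$$
   Context: A finite MDP with horizon $T=1$ consists of a finite state set $\mathcal S$ with $S=|\mathcal S|$, a finite action set $\mathcal A$ with $A=|\mathcal A|$, a transition function $p$ where $p(s,a,\cdot)$ is a probability distribution on $\mathcal S$ for each $(s,a)$, a reward function $r:\mathcal S\times\mathcal A\times\mathcal S\to\mathbb R$, and an initial distribution $\hat{\boldsymbol p}$ on $\mathcal S$ with $\hat p_s>0$ for every $s\in\mathcal S$. $\Delta_S$ and $\Delta_A$ are the sets of probability vectors indexed by $\mathcal S$ and $\mathcal A$. $\Pi$ is the set of randomized policies $\boldsymbol\pi:\mathcal S\to\Delta_A$. The random variables are: $\tilde s\sim\hat{\boldsymbol p}$; the action $\tilde a$, distributed according to $\boldsymbol\pi(\tilde s)$ given $\tilde s$ (superscript $\tilde a\sim\boldsymbol\pi(\tilde s)$), or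 according to $\boldsymbol d$ (superscript $\tilde a\sim\boldsymbol d$); and $\tilde s'\sim p(\tilde s,\tilde a,\cdot)$ given $(\tilde s,\tilde a)$. A risk measure written with "$\mid\tilde s=s$" is evaluated under the conditional distribution given $\tilde s=s$. For a real random variable $\tilde x$ on a finite probability space and $\alpha\in[0,1]$, $\mathrm{VaR}_\alpha[\tilde x]=\sup\{z\in\mathbb R\mid\mathbb P[\tilde x<z]\le\alpha\}=\inf\{z\in\mathbb R\mid\mathbb P[\tilde x\le z]>\alpha\}$, with values in the extended reals; in particular $\mathrm{VaR}_1[\tilde x]=\infty$. A minimum whose terms are all $\infty$ equals $\infty$. *)

theory Defs
  imports "HOL-Probability.Probability"
begin

text \<open>
  The state and action sets are types of class \<open>finite\<close>, and the probability vectors indexed by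
  a finite type \<open>'i\<close> are the elements of \<open>'i pmf\<close>.
\<close>

text \<open>
  For \<open>\<alpha>\<close> between 0 and 1 this is the largest \<open>\<alpha>\<close>-quantile, also expressible as
  \<open>Inf {ereal z | z. P (X \<le> z) > \<alpha>}\<close>. It is \<open>\<infinity>\<close> for \<open>\<alpha> = 1\<close>.
\<close>

definition VaR :: "real \<Rightarrow> 'w pmf \<Rightarrow> ('w \<Rightarrow> real) \<Rightarrow> ereal" where
  "VaR \<alpha> P X = Sup {ereal z | z. measure_pmf.prob P {\<omega>. X \<omega> < z} \<le> \<alpha>}"

text \<open>The joint distribution of (state, action, next state) over the horizon 1.\<close>

definition mdp_pmf ::
  "'s pmf \<Rightarrow> ('s \<Rightarrow> 'a \<Rightarrow> 's pmf) \<Rightarrow> ('s \<Rightarrow> 'a pmf) \<Rightarrow> ('s \<times> 'a \<times> 's) pmf" where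
  "mdp_pmf p0 p \<pi> =
     bind_pmf p0 (\<lambda>s. bind_pmf (\<pi> s) (\<lambda>a. bind_pmf (p s a) (\<lambda>s'. return_pmf (s, a, s'))))"

text \<open>
  The conditional distribution given that the initial state is \<open>s\<close>, when the action is drawn from
  \<open>d\<close> regardless of the state. \<open>cond_pmf\<close> is meaningful only if the conditioning event has positive
  probability, that is, if \<open>pmf p0 s > 0\<close>.
\<close>

definition mdp_cond_pmf ::
  "'s pmf \<Rightarrow> ('s \<Rightarrow> 'a \<Rightarrow> 's pmf) \<Rightarrow> 'a pmf \<Rightarrow> 's \<Rightarrow> ('s \<times> 'a \<times> 's) pmf" where
  "mdp_cond_pmf p0 p d s = cond_pmf (mdp_pmf p0 p (\<lambda>_. d)) {\<omega>. fst \<omega> = s}"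

definition VaR_policy ::
  "'s pmf \<Rightarrow> ('s \<Rightarrow> 'a \<Rightarrow> 's pmf) \<Rightarrow> ('s \<Rightarrow> 'a \<Rightarrow> 's \<Rightarrow> real) \<Rightarrow> real \<Rightarrow> ('s \<Rightarrow> 'a pmf) \<Rightarrow> ereal" where
  "VaR_policy p0 p r \<alpha> \<pi> = VaR \<alpha> (mdp_pmf p0 p \<pi>) (\<lambda>(s, a, s'). r s a s')"

definition VaR_cond ::
  "'s pmf \<Rightarrow> ('s \<Rightarrow> 'a \<Rightarrow> 's pmf) \<Rightarrow> ('s \<Rightarrow> 'a \<Rightarrow> 's \<Rightarrow> real) \<Rightarrow> 's \<Rightarrow> real \<Rightarrow> 'a pmf \<Rightarrow> ereal" where
  "VaR_cond p0 p r s \<beta> d = VaR \<beta> (mdp_cond_pmf p0 p d s) (\<lambda>(_, a, s'). r s a s')"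

end

theory Submission
  imports Defs
begin

text \<open>
  Both sides compare the same level sets. The risk of a policy \<open>\<pi>\<close> is at least \<open>z\<close> when
  the shortfall probability of \<open>z\<close>, which splits as the sum over \<open>s\<close> of \<open>pmf p0 s * q s\<close> with \<open>q s\<close>
  the shortfall probability conditional on the initial state \<open>s\<close>, is at most \<open>\<alpha>\<close>. A vector \<open>\<zeta>\<close>
  distributes the budget \<open>\<alpha>\<close> over the states: the conditional risk at state \<open>s\<close> is at least \<open>z\<close> when
  \<open>pmf p0 s * q s \<le> \<alpha> * pmf \<zeta> s\<close>.

  Summing these constraints over \<open>s\<close> gives the total constraint, and as a policy chooses its action
  distribution separately in each state, good choices at the single states combine into one policy
  (\<open>VaR_policy_ge_of_VaR_conds\<close>). Conversely, a policy that keeps the total budget admits a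
  distribution \<open>\<zeta>\<close> of it that meets every single constraint and still satisfies
  \<open>\<alpha> * pmf \<zeta> s \<le> pmf p0 s\<close>: there is room because \<open>q s \<le> 1\<close> and \<open>\<alpha> \<le> 1\<close>
  (\<open>budget_allocation\<close>). The action distributions of the policy then witness the right-hand side.

  The suprema over policies and over action distributions are attained because the value-at-risk of
  a fixed function on a finite space takes only finitely many values as the distribution varies
  (\<open>finite_range_VaR\<close>).
\<close>

section \<open>Value-at-risk\<close>

lemma VaR_ge:
  "measure_pmf.prob P {\<omega>. X \<omega> < z} \<le> \<beta> \<Longrightarrow> ereal z \<le> VaR \<beta> P X"
  unfolding VaR_def by (intro Sup_upper) auto

lemma less_VaR_iff:
  "y < VaR \<beta> P X \<longleftrightarrow> (\<exists>z. y < ereal z \<and> measure_pmf.prob P {\<omega>. X \<omega> < z} \<le> \<beta>)"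
  unfolding VaR_def less_Sup_iff by auto

text \<open>
  The value is determined by the collection of those subsets of the sample space whose probability
  is at most \<open>\<beta>\<close>, and a finite space has only finitely many collections of subsets.
\<close>

lemma finite_range_VaR:
  fixes P :: "'b \<Rightarrow> 'w::finite pmf"
  shows "finite (range (\<lambda>x. VaR \<beta> (P x) X))"
proof (rule finite_subset)
  let ?G = "\<lambda>\<A>. Sup {ereal z | z. {\<omega>. X \<omega> < z} \<in> \<A>}"
  have "VaR \<beta> (P x) X = ?G {A. measure_pmf.prob (P x) A \<le> \<beta>}" for x
    by (simp add: VaR_def)
  then show "range (\<lambda>x. VaR \<beta> (P x) X) \<subseteq> range ?G" by blast
qed simp

lemma ex_is_arg_max_of_finite_range:
  fixes f :: "'b \<Rightarrow> 'c::linorder"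
  assumes "finite (range f)"
  shows "\<exists>x. is_arg_max f (\<lambda>_. True) x"
proof -
  from assms have "Max (range f) \<in> range f" by (intro Max_in) auto
  then obtain x where "f x = Max (range f)" by (metis imageE)
  with assms show ?thesis by (auto simp: is_arg_max_def not_less intro!: exI[of _ x])
qed

section \<open>Conditioning on the initial state\<close>

text \<open>
  If the first stage of a two-stage experiment can be read off from the outcome, then conditioning
  on its result leaves the law of the second stage.
\<close>

lemma cond_bind_pmf_of_readable:
  assumes read: "\<And>x \<omega>. \<omega> \<in> set_pmf (K x) \<Longrightarrow> f \<omega> = x" and x: "x \<in> set_pmf P"
  shows "cond_pmf (bind_pmf P K) {\<omega>. f \<omega> = x} = K x"
proof (rule pmf_eqI)
  fix \<omega>
  have ne: "set_pmf (bind_pmf P K) \<inter> {\<omega>. f \<omega> = x} \<noteq> {}"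
    using x read set_pmf_not_empty[of "K x"] by fastforce
  have "map_pmf f (K y) = return_pmf y" for y
    using map_pmf_cong[of "K y" "K y" f "\<lambda>_. y"] read by simp
  then have "map_pmf f (bind_pmf P K) = P"
    by (simp add: map_bind_pmf bind_return_pmf')
  then have prob: "measure_pmf.prob (bind_pmf P K) {\<omega>. f \<omega> = x} = pmf P x"
    using pmf_map[of f "bind_pmf P K" x] by (simp add: vimage_def)
  show "pmf (cond_pmf (bind_pmf P K) {\<omega>. f \<omega> = x}) \<omega> = pmf (K x) \<omega>"
  proof (cases "f \<omega> = x")
    case True
    then have "pmf (K y) \<omega> = indicator {x} y * pmf (K x) \<omega>" for y
      using read[of \<omega> y] by (auto simp: set_pmf_iff indicator_def)
    then have "pmf (bind_pmf P K) \<omega> = (\<integral>y. indicator {x} y * pmf (K x) \<omega> \<partial>P)"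
      unfolding pmf_bind by metis
    also have "\<dots> = pmf P x * pmf (K x) \<omega>"
      by (simp add: measure_pmf_single)
    finally have "pmf (bind_pmf P K) \<omega> = pmf P x * pmf (K x) \<omega>" .
    with x True show ?thesis by (simp add: pmf_cond[OF ne] prob set_pmf_iff)
  next
    case False
    with read[of \<omega> x] show ?thesis by (auto simp: pmf_cond[OF ne] set_pmf_iff)
  qed
qed

definition step_pmf :: "('s \<Rightarrow> 'a \<Rightarrow> 's pmf) \<Rightarrow> 'a pmf \<Rightarrow> 's \<Rightarrow> ('s \<times> 'a \<times> 's) pmf" where
  "step_pmf p d s = bind_pmf d (\<lambda>a. bind_pmf (p s a) (\<lambda>s'. return_pmf (s, a, s')))"

definition shortfall ::
  "('s \<Rightarrow> 'a \<Rightarrow> 's pmf) \<Rightarrow> ('s \<Rightarrow> 'a \<Rightarrow> 's \<Rightarrow> real) \<Rightarrow> 's \<Rightarrow> 'a pmf \<Rightarrow> real \<Rightarrow> real" where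
  "shortfall p r s d z = measure_pmf.prob (step_pmf p d s) {(s, a, s'). r s a s' < z}"

lemma shortfall_mono: "z \<le> z' \<Longrightarrow> shortfall p r s d z \<le> shortfall p r s d z'"
  unfolding shortfall_def by (intro measure_pmf.finite_measure_mono) auto

lemma set_step_pmf: "\<omega> \<in> set_pmf (step_pmf p d s) \<Longrightarrow> fst \<omega> = s"
  by (auto simp: step_pmf_def)

lemma mdp_pmf_eq_bind: "mdp_pmf p0 p \<pi> = bind_pmf p0 (\<lambda>s. step_pmf p (\<pi> s) s)"
  by (simp add: mdp_pmf_def step_pmf_def)

lemma mdp_cond_pmf_eq_step_pmf:
  assumes "pmf p0 s > 0"
  shows "mdp_cond_pmf p0 p d s = step_pmf p d s"
  unfolding mdp_cond_pmf_def mdp_pmf_eq_bind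
  by (rule cond_bind_pmf_of_readable) (use assms in \<open>auto simp: set_step_pmf set_pmf_iff\<close>)

lemma prob_cond_less_eq_shortfall:
  assumes "pmf p0 s > 0"
  shows "measure_pmf.prob (mdp_cond_pmf p0 p d s) {\<omega>. (\<lambda>(_, a, s'). r s a s') \<omega> < z}
    = shortfall p r s d z"
  unfolding mdp_cond_pmf_eq_step_pmf[OF assms] shortfall_def
  by (intro measure_pmf.finite_measure_eq_AE) (auto simp: AE_measure_pmf_iff dest: set_step_pmf)

lemma prob_policy_less_eq_sum_shortfall:
  fixes p0 :: "'s::finite pmf"
  shows "measure_pmf.prob (mdp_pmf p0 p \<pi>) {\<omega>. (\<lambda>(s, a, s'). r s a s') \<omega> < z}
    = (\<Sum>s\<in>UNIV. pmf p0 s * shortfall p r s (\<pi> s) z)"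
proof -
  have "measure_pmf.prob (bind_pmf p0 K) A = (\<Sum>s\<in>UNIV. pmf p0 s * measure_pmf.prob (K s) A)"
    for K :: "'s \<Rightarrow> ('s \<times> 'b \<times> 's) pmf" and A
    unfolding measure_pmf_bind
    by (subst measure_pmf.measure_bind[where N = "count_space UNIV"])
      (auto simp: integral_measure_pmf_real[where A = UNIV] mult.commute
        measurable_def space_subprob_algebra measure_pmf.subprob_space_axioms)
  then show ?thesis
    by (simp add: mdp_pmf_eq_bind shortfall_def case_prod_unfold)
qed

lemma less_VaR_cond_iff:
  assumes "pmf p0 s > 0"
  shows "y < VaR_cond p0 p r s \<beta> d \<longleftrightarrow> (\<exists>z. y < ereal z \<and> shortfall p r s d z \<le> \<beta>)"
  unfolding VaR_cond_def less_VaR_iff prob_cond_less_eq_shortfall[OF assms] ..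

lemma VaR_cond_ge:
  assumes "pmf p0 s > 0" and "shortfall p r s d z \<le> \<beta>"
  shows "ereal z \<le> VaR_cond p0 p r s \<beta> d"
  unfolding VaR_cond_def by (rule VaR_ge) (simp only: prob_cond_less_eq_shortfall assms)

section \<open>Allocating the risk budget\<close>

text \<open>
  The point \<open>c + t *\<^sub>R (b - c)\<close> of the segment from \<open>c\<close> to \<open>b\<close> with coordinate sum \<open>\<alpha>\<close>, rescaled by
  \<open>\<alpha>\<close>, is the required probability vector. For \<open>\<alpha> = 0\<close> all \<open>c s\<close> vanish and any vector works.
\<close>

lemma budget_allocation:
  fixes b :: "'s::finite pmf" and c :: "'s \<Rightarrow> real"
  assumes c0: "\<And>s. 0 \<le> c s" and cb: "\<And>s. c s \<le> pmf b s"
    and sum: "(\<Sum>s\<in>UNIV. c s) \<le> \<alpha>" and \<alpha>0: "0 \<le> \<alpha>" and \<alpha>1: "\<alpha> \<le> 1"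
  obtains \<zeta> :: "'s pmf" where "\<And>s. c s \<le> \<alpha> * pmf \<zeta> s" "\<And>s. \<alpha> * pmf \<zeta> s \<le> pmf b s"
proof (cases "\<alpha> = 0")
  case True
  with sum c0 have "(\<Sum>s\<in>UNIV. c s) = 0" by (simp add: antisym sum_nonneg)
  with c0 have "c s = 0" for s by (simp add: sum_nonneg_eq_0_iff)
  with True that[of b] show thesis by simp
next
  case False
  define m where "m = (\<Sum>s\<in>UNIV. c s)"
  \<comment> \<open>If \<open>m = 1\<close>, then \<open>\<alpha> = 1\<close> and \<open>t = 0 / 0 = 0\<close> is the right choice.\<close>
  define t where "t = (\<alpha> - m) / (1 - m)"
  define w where "w s = c s + t * (pmf b s - c s)" for s
  have m: "m \<le> \<alpha>" using sum by (simp add: m_def)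
  have b1: "(\<Sum>s\<in>UNIV. pmf b s) = 1" by (simp add: sum_pmf_eq_1)
  have t: "0 \<le> t" "t \<le> 1" using m \<alpha>1 by (auto simp: t_def divide_simps)
  have "t * (1 - m) = \<alpha> - m" using m \<alpha>1 by (auto simp: t_def)
  then have w_sum: "(\<Sum>s\<in>UNIV. w s) = \<alpha>"
    unfolding w_def by (simp add: sum.distrib sum_subtractf b1 flip: sum_distrib_left m_def)
  have cw: "c s \<le> w s" for s using t cb[of s] by (simp add: w_def)
  have wb: "w s \<le> pmf b s" for s
    using t mult_right_mono[of t 1 "pmf b s - c s"] cb[of s] by (simp add: w_def)
  have w0: "0 \<le> w s / \<alpha>" for s using c0[of s] cw[of s] \<alpha>0 by simp
  have "(\<Sum>s\<in>UNIV. w s / \<alpha>) = 1" using w_sum False by (simp flip: sum_divide_distrib)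
  then have "(\<integral>\<^sup>+s. ennreal (w s / \<alpha>) \<partial>count_space UNIV) = 1"
    using w0 by (simp add: nn_integral_count_space_finite sum_ennreal)
  then have "pmf (embed_pmf (\<lambda>s. w s / \<alpha>)) s = w s / \<alpha>" for s
    using w0 by (intro pmf_embed_pmf) auto
  with cw wb False show thesis by (intro that[of "embed_pmf (\<lambda>s. w s / \<alpha>)"]) simp_all
qed

section \<open>The decomposition\<close>

text \<open>
  Action distributions for the single states, with levels \<open>z s\<close> above \<open>y\<close>, form a policy. The
  least of these levels is still above \<open>y\<close> because there are finitely many states, and under this
  policy its shortfall probability is at most \<open>\<alpha>\<close>.
\<close>

lemma VaR_policy_ge_of_VaR_conds:
  fixes p0 \<zeta> :: "'s::finite pmf"
  assumes pos: "\<And>s. pmf p0 s > 0"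
    and less: "\<And>s. y < VaR_cond p0 p r s (\<alpha> * pmf \<zeta> s / pmf p0 s) (\<pi> s)"
  shows "y \<le> VaR_policy p0 p r \<alpha> \<pi>"
proof -
  from less obtain z where z: "\<And>s. y < ereal (z s)"
      "\<And>s. shortfall p r s (\<pi> s) (z s) \<le> \<alpha> * pmf \<zeta> s / pmf p0 s"
    unfolding less_VaR_cond_iff[OF pos] by metis
  define m where "m = Min (range z)"
  have "m \<in> range z" unfolding m_def by (rule Min_in) auto
  with z(1) have "y < ereal m" by auto
  have "pmf p0 s * shortfall p r s (\<pi> s) m \<le> \<alpha> * pmf \<zeta> s" for s
  proof -
    have "shortfall p r s (\<pi> s) m \<le> \<alpha> * pmf \<zeta> s / pmf p0 s"
      using shortfall_mono[of m "z s"] z(2)[of s] by (force simp: m_def intro: order_trans)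
    with pos[of s] show ?thesis by (simp add: pos_le_divide_eq mult.commute)
  qed
  then have "(\<Sum>s\<in>UNIV. pmf p0 s * shortfall p r s (\<pi> s) m) \<le> (\<Sum>s\<in>UNIV. \<alpha> * pmf \<zeta> s)"
    by (intro sum_mono)
  also have "\<dots> = \<alpha>" by (simp add: sum_pmf_eq_1 flip: sum_distrib_left)
  finally have "ereal m \<le> VaR_policy p0 p r \<alpha> \<pi>"
    unfolding VaR_policy_def by (intro VaR_ge) (simp only: prob_policy_less_eq_sum_shortfall)
  with \<open>y < ereal m\<close> show ?thesis by simp
qed

theorem theorem5p2:
  fixes p0 :: "'s::finite pmf"
    and p :: "'s \<Rightarrow> 'a::finite \<Rightarrow> 's pmf"
    and r :: "'s \<Rightarrow> 'a \<Rightarrow> 's \<Rightarrow> real"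
    and \<alpha> :: real
  assumes "\<forall>s. pmf p0 s > 0"
    and "0 \<le> \<alpha>" and "\<alpha> \<le> 1"
  shows "(\<exists>\<pi>. is_arg_max (VaR_policy p0 p r \<alpha>) (\<lambda>_. True) \<pi>)
    \<and> (\<forall>\<zeta>::'s pmf. (\<forall>s. \<alpha> * pmf \<zeta> s \<le> pmf p0 s) \<longrightarrow>
         (\<forall>s. \<exists>d. is_arg_max (VaR_cond p0 p r s (\<alpha> * pmf \<zeta> s / pmf p0 s)) (\<lambda>_. True) d))
    \<and> (SUP \<pi>. VaR_policy p0 p r \<alpha> \<pi>)
      = (SUP \<zeta>\<in>{\<zeta>::'s pmf. \<forall>s. \<alpha> * pmf \<zeta> s \<le> pmf p0 s}.
           MIN s. SUP d. VaR_cond p0 p r s (\<alpha> * pmf \<zeta> s / pmf p0 s) d)"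
    (is "_ \<and> _ \<and> ?L = ?R")
proof (intro conjI allI impI)
  show "\<exists>\<pi>. is_arg_max (VaR_policy p0 p r \<alpha>) (\<lambda>_. True) \<pi>"
    unfolding VaR_policy_def by (intro ex_is_arg_max_of_finite_range finite_range_VaR)
  show "\<exists>d. is_arg_max (VaR_cond p0 p r s (\<alpha> * pmf \<zeta> s / pmf p0 s)) (\<lambda>_. True) d"
    for \<zeta> :: "'s pmf" and s
    unfolding VaR_cond_def by (intro ex_is_arg_max_of_finite_range finite_range_VaR)
  have pos: "pmf p0 s > 0" for s using assms(1) by blast
  show "?L = ?R"
  proof (rule antisym)
    show "?L \<le> ?R"
      unfolding VaR_policy_def VaR_def
    proof (intro SUP_least Sup_least, clarify)
      fix \<pi> z
      assume "measure_pmf.prob (mdp_pmf p0 p \<pi>) {\<omega>. (case \<omega> of (s, a, s') \<Rightarrow> r s a s') < z} \<le> \<alpha>"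
      then have total: "(\<Sum>s\<in>UNIV. pmf p0 s * shortfall p r s (\<pi> s) z) \<le> \<alpha>"
        by (simp only: prob_policy_less_eq_sum_shortfall)
      have "0 \<le> pmf p0 s * shortfall p r s (\<pi> s) z"
        and "pmf p0 s * shortfall p r s (\<pi> s) z \<le> pmf p0 s" for s
        by (simp_all add: shortfall_def mult_left_le)
      from budget_allocation[OF this total assms(2,3)] obtain \<zeta> :: "'s pmf"
        where \<zeta>: "\<And>s. pmf p0 s * shortfall p r s (\<pi> s) z \<le> \<alpha> * pmf \<zeta> s"
          "\<And>s. \<alpha> * pmf \<zeta> s \<le> pmf p0 s"
        by blast
      have "ereal z \<le> (SUP d. VaR_cond p0 p r s (\<alpha> * pmf \<zeta> s / pmf p0 s) d)" for s
        using \<zeta>(1)[of s] pos[of s]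
        by (intro SUP_upper2[of "\<pi> s"] VaR_cond_ge) (simp_all add: pos_le_divide_eq mult.commute)
      then show "ereal z \<le> ?R"
        using \<zeta>(2) by (intro SUP_upper2[of \<zeta>]) auto
    qed
    show "?R \<le> ?L"
    proof (rule SUP_least, rule dense_le)
      fix \<zeta> :: "'s pmf" and y
      assume "y < (MIN s. SUP d. VaR_cond p0 p r s (\<alpha> * pmf \<zeta> s / pmf p0 s) d)"
      then have "\<forall>s. \<exists>d. y < VaR_cond p0 p r s (\<alpha> * pmf \<zeta> s / pmf p0 s) d"
        by (simp add: less_SUP_iff)
      then obtain \<pi> where "\<And>s. y < VaR_cond p0 p r s (\<alpha> * pmf \<zeta> s / pmf p0 s) (\<pi> s)"
        by metis
      with pos have "y \<le> VaR_policy p0 p r \<alpha> \<pi>" by (rule VaR_policy_ge_of_VaR_conds)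
      then show "y \<le> ?L" by (intro SUP_upper2[of \<pi>]) simp
    qed
  qed
qed

end
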